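(* Let $G$ and $H$ be finite groups of coprime orders, considered as categories. Then limits over $G$ commute with colimits over $H$ in $\mathbf{Set}$.
   Context: A group is considered as a category with one object, whose morphisms are the elements of the group and whose composition is the group multiplication. For small categories $\mathbb{I}$ and $\mathbb{J}$, limits over $\mathbb{I}$ commute with colimits over $\mathbb{J}$ in $\mathbf{Set}$ if, for every functor $F:\mathbb{I}\times\mathbb{J}\to\mathbf{Set}$, the canonical map $\operatorname{colim}_{j\in\mathbb{J}}\lim_{i\in\mathbb{I}}F(i,j)\to\lim_{i\in\mathbb{I}}\operatorname{colim}_{j\in\mathbb{J}}F(i,j)$ is a bijection. *)

theory Defs
  imports "HOL-Algebra.Coset"
begin

section \<open>Small categories\<close>

text \<open>Composition is written in the usual order: \<open>Comp C g f\<close> is ``\<open>g\<close> after \<open>f\<close>'', and is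
  only meaningful when \<open>Dom C g = Cod C f\<close>.\<close>

record ('o, 'a) cat =
  Ob :: "'o set"
  Arr :: "'a set"
  Dom :: "'a \<Rightarrow> 'o"
  Cod :: "'a \<Rightarrow> 'o"
  Id :: "'o \<Rightarrow> 'a"
  Comp :: "'a \<Rightarrow> 'a \<Rightarrow> 'a"

locale small_category =
  fixes C :: "('o, 'a) cat"
  assumes Dom_in: "f \<in> Arr C \<Longrightarrow> Dom C f \<in> Ob C"
    and Cod_in: "f \<in> Arr C \<Longrightarrow> Cod C f \<in> Ob C"
    and Id_in: "x \<in> Ob C \<Longrightarrow> Id C x \<in> Arr C"
    and Dom_Id: "x \<in> Ob C \<Longrightarrow> Dom C (Id C x) = x"
    and Cod_Id: "x \<in> Ob C \<Longrightarrow> Cod C (Id C x) = x"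
    and Comp_in: "\<lbrakk>f \<in> Arr C; g \<in> Arr C; Dom C g = Cod C f\<rbrakk> \<Longrightarrow> Comp C g f \<in> Arr C"
    and Dom_Comp: "\<lbrakk>f \<in> Arr C; g \<in> Arr C; Dom C g = Cod C f\<rbrakk> \<Longrightarrow> Dom C (Comp C g f) = Dom C f"
    and Cod_Comp: "\<lbrakk>f \<in> Arr C; g \<in> Arr C; Dom C g = Cod C f\<rbrakk> \<Longrightarrow> Cod C (Comp C g f) = Cod C g"
    and Comp_Id_right: "f \<in> Arr C \<Longrightarrow> Comp C f (Id C (Dom C f)) = f"
    and Comp_Id_left: "f \<in> Arr C \<Longrightarrow> Comp C (Id C (Cod C f)) f = f"
    and Comp_assoc:
      "\<lbrakk>f \<in> Arr C; g \<in> Arr C; h \<in> Arr C; Dom C g = Cod C f; Dom C h = Cod C g\<rbrakk>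
        \<Longrightarrow> Comp C h (Comp C g f) = Comp C (Comp C h g) f"

definition prod_cat :: "('o, 'a) cat \<Rightarrow> ('p, 'b) cat \<Rightarrow> ('o \<times> 'p, 'a \<times> 'b) cat" where
  "prod_cat I J =
    \<lparr>Ob = Ob I \<times> Ob J,
     Arr = Arr I \<times> Arr J,
     Dom = map_prod (Dom I) (Dom J),
     Cod = map_prod (Cod I) (Cod J),
     Id = map_prod (Id I) (Id J),
     Comp = (\<lambda>(g, g') (f, f'). (Comp I g f, Comp J g' f'))\<rparr>"

definition group_cat :: "('g, 'x) monoid_scheme \<Rightarrow> (unit, 'g) cat" where
  "group_cat G =
    \<lparr>Ob = {()},
     Arr = carrier G,
     Dom = (\<lambda>_. ()),
     Cod = (\<lambda>_. ()),
     Id = (\<lambda>_. \<one>\<^bsub>G\<^esub>),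
     Comp = (\<lambda>g f. g \<otimes>\<^bsub>G\<^esub> f)\<rparr>"

lemma small_category_prod_cat:
  assumes "small_category I" and "small_category J"
  shows "small_category (prod_cat I J)"
proof -
  interpret I: small_category I by fact
  interpret J: small_category J by fact
  show ?thesis
    by unfold_locales
      (auto simp: prod_cat_def I.Dom_in J.Dom_in I.Cod_in J.Cod_in I.Id_in J.Id_in
        I.Dom_Id J.Dom_Id I.Cod_Id J.Cod_Id I.Comp_in J.Comp_in I.Dom_Comp J.Dom_Comp
        I.Cod_Comp J.Cod_Comp I.Comp_Id_right J.Comp_Id_right I.Comp_Id_left J.Comp_Id_left
        I.Comp_assoc J.Comp_assoc)
qed

lemma small_category_group_cat:
  assumes "group G"
  shows "small_category (group_cat G)"
proof -
  interpret group G by fact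
  show ?thesis
    by unfold_locales (auto simp: group_cat_def m_assoc)
qed


section \<open>Functors to sets\<close>

text \<open>A functor takes values in the subsets of a type \<open>'c\<close>. Its value on an arrow is a function
  on all of \<open>'c\<close>, of which only the restriction to the source set is relevant.\<close>

record ('o, 'a, 'c) set_functor =
  obj_map :: "'o \<Rightarrow> 'c set"
  arr_map :: "'a \<Rightarrow> 'c \<Rightarrow> 'c"

locale functor_to_Set =
  fixes C :: "('o, 'a) cat" and D :: "('o, 'a, 'c) set_functor"
  assumes arr_map_in:
      "\<lbrakk>f \<in> Arr C; x \<in> obj_map D (Dom C f)\<rbrakk> \<Longrightarrow> arr_map D f x \<in> obj_map D (Cod C f)"
    and arr_map_Id: "\<lbrakk>a \<in> Ob C; x \<in> obj_map D a\<rbrakk> \<Longrightarrow> arr_map D (Id C a) x = x"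
    and arr_map_Comp:
      "\<lbrakk>f \<in> Arr C; g \<in> Arr C; Dom C g = Cod C f; x \<in> obj_map D (Dom C f)\<rbrakk>
        \<Longrightarrow> arr_map D (Comp C g f) x = arr_map D g (arr_map D f x)"


section \<open>Limits and colimits of sets\<close>

text \<open>The limit is the set of compatible families; families are extensional, i.e. \<open>undefined\<close>
  outside \<open>Ob C\<close>, so that distinct functions are distinct families.\<close>

definition limit :: "('o, 'a) cat \<Rightarrow> ('o, 'a, 'c) set_functor \<Rightarrow> ('o \<Rightarrow> 'c) set" where
  "limit C D =
    {s \<in> (\<Pi>\<^sub>E a \<in> Ob C. obj_map D a). \<forall>f \<in> Arr C. arr_map D f (s (Dom C f)) = s (Cod C f)}"

text \<open>The colimit is the quotient of the disjoint union of the values of \<open>D\<close> by the equivalence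
  relation generated by \<open>(a, x) \<sim> (b, D f x)\<close> for \<open>f : a \<rightarrow> b\<close> and \<open>x \<in> D a\<close>. The relation
  \<open>colimit_rel\<close> is also reflexive outside the disjoint union, which does not affect the quotient.\<close>

definition colimit_rel ::
    "('o, 'a) cat \<Rightarrow> ('o, 'a, 'c) set_functor \<Rightarrow> (('o \<times> 'c) \<times> ('o \<times> 'c)) set" where
  "colimit_rel C D =
    (let r = {((Dom C f, x), (Cod C f, arr_map D f x)) | f x. f \<in> Arr C \<and> x \<in> obj_map D (Dom C f)}
     in (r \<union> r\<inverse>)\<^sup>*)"

definition colimit :: "('o, 'a) cat \<Rightarrow> ('o, 'a, 'c) set_functor \<Rightarrow> ('o \<times> 'c) set set" where
  "colimit C D = (SIGMA a : Ob C. obj_map D a) // colimit_rel C D"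

text \<open>The maps induced on limits and colimits by the components \<open>\<phi> a : D a \<rightarrow> E a\<close> of a natural
  transformation from \<open>D\<close> to \<open>E\<close>. On colimits, a class \<open>c\<close> goes to the class of \<open>(a, \<phi> a x)\<close> for
  any \<open>(a, x) \<in> c\<close>; here this is the saturation of the image of \<open>c\<close>.\<close>

definition limit_map :: "('o, 'a) cat \<Rightarrow> ('o \<Rightarrow> 'c \<Rightarrow> 'd) \<Rightarrow> ('o \<Rightarrow> 'c) \<Rightarrow> ('o \<Rightarrow> 'd)" where
  "limit_map C \<phi> s = (\<lambda>a \<in> Ob C. \<phi> a (s a))"

definition colimit_map ::
    "('o, 'a) cat \<Rightarrow> ('o, 'a, 'd) set_functor \<Rightarrow> ('o \<Rightarrow> 'c \<Rightarrow> 'd) \<Rightarrow> ('o \<times> 'c) set \<Rightarrow> ('o \<times> 'd) set" where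
  "colimit_map C E \<phi> c = colimit_rel C E `` ((\<lambda>(a, x). (a, \<phi> a x)) ` c)"

lemma limit_universal:
  assumes cone: "\<And>a t. \<lbrakk>a \<in> Ob C; t \<in> T\<rbrakk> \<Longrightarrow> p a t \<in> obj_map D a"
    and compatible: "\<And>f t. \<lbrakk>f \<in> Arr C; t \<in> T\<rbrakk> \<Longrightarrow> arr_map D f (p (Dom C f) t) = p (Cod C f) t"
    and "small_category C"
  shows "\<exists>!u. u \<in> T \<rightarrow>\<^sub>E limit C D \<and> (\<forall>a \<in> Ob C. \<forall>t \<in> T. u t a = p a t)"
proof
  interpret small_category C by fact
  let ?u = "\<lambda>t \<in> T. \<lambda>a \<in> Ob C. p a t"
  show "?u \<in> T \<rightarrow>\<^sub>E limit C D \<and> (\<forall>a \<in> Ob C. \<forall>t \<in> T. ?u t a = p a t)"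
    using cone compatible by (auto simp: limit_def Dom_in Cod_in)
  fix u assume u: "u \<in> T \<rightarrow>\<^sub>E limit C D \<and> (\<forall>a \<in> Ob C. \<forall>t \<in> T. u t a = p a t)"
  show "u = ?u"
  proof
    fix t
    show "u t = ?u t"
    proof (cases "t \<in> T")
      case True
      then have "u t \<in> (\<Pi>\<^sub>E a \<in> Ob C. obj_map D a)"
        using u by (auto simp: limit_def)
      then show ?thesis
        using True u by (auto simp: fun_eq_iff PiE_def extensional_def)
    next
      case False
      then show ?thesis using u by (auto simp: PiE_def extensional_def)
    qed
  qed
qed

lemma equiv_colimit_rel: "equiv UNIV (colimit_rel C D)"
proof -
  have "sym ((r \<union> r\<inverse>)\<^sup>*)" for r :: "('x \<times> 'x) set"
    by (rule sym_rtrancl) (auto simp: sym_def)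
  then show ?thesis
    by (auto simp: equiv_def colimit_rel_def Let_def refl_rtrancl trans_rtrancl)
qed

lemma colimit_rel_refl: "(y, y) \<in> colimit_rel C D"
  by (simp add: colimit_rel_def Let_def)

lemma colimit_rel_arr:
  assumes "f \<in> Arr C" and "x \<in> obj_map D (Dom C f)"
  shows "((Dom C f, x), (Cod C f, arr_map D f x)) \<in> colimit_rel C D"
  using assms unfolding colimit_rel_def Let_def by (intro r_into_rtrancl) blast

lemma colimit_rel_induct [consumes 1, case_names refl arr sym trans]:
  assumes "(y, z) \<in> colimit_rel C D"
    and refl: "\<And>y. P y y"
    and arr: "\<And>f x. \<lbrakk>f \<in> Arr C; x \<in> obj_map D (Dom C f)\<rbrakk>
      \<Longrightarrow> P (Dom C f, x) (Cod C f, arr_map D f x)"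
    and sym: "\<And>y z. P y z \<Longrightarrow> P z y"
    and trans: "\<And>x y z. \<lbrakk>P x y; P y z\<rbrakk> \<Longrightarrow> P x z"
  shows "P y z"
  using assms(1) unfolding colimit_rel_def Let_def
proof (induction rule: rtrancl_induct)
  case base
  then show ?case by (rule refl)
next
  case (step y' z')
  then have "P y' z'" using arr sym by fast
  with step.IH show ?case by (rule trans)
qed

lemma colimit_universal:
  assumes cocone: "\<And>a x. \<lbrakk>a \<in> Ob C; x \<in> obj_map D a\<rbrakk> \<Longrightarrow> q a x \<in> T"
    and compatible: "\<And>f x. \<lbrakk>f \<in> Arr C; x \<in> obj_map D (Dom C f)\<rbrakk>
      \<Longrightarrow> q (Cod C f) (arr_map D f x) = q (Dom C f) x"
  shows "\<exists>!u. u \<in> colimit C D \<rightarrow>\<^sub>E T \<and>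
    (\<forall>a \<in> Ob C. \<forall>x \<in> obj_map D a. u (colimit_rel C D `` {(a, x)}) = q a x)"
proof
  let ?R = "colimit_rel C D"
  let ?u = "\<lambda>c \<in> colimit C D. case (SOME y. y \<in> c) of (a, x) \<Rightarrow> q a x"
  have const: "case_prod q y = case_prod q z" if "(y, z) \<in> ?R" for y z
    using that by (induction rule: colimit_rel_induct) (auto simp: compatible)
  have some: "(case (SOME y. y \<in> ?R `` {z}) of (a, x) \<Rightarrow> q a x) = case_prod q z" for z
  proof -
    have "z \<in> ?R `` {z}" by (simp add: colimit_rel_refl)
    then have "(SOME y. y \<in> ?R `` {z}) \<in> ?R `` {z}" by (rule someI)
    then show ?thesis using const[of z] by (metis Image_singleton_iff)
  qed
  show "?u \<in> colimit C D \<rightarrow>\<^sub>E T \<and> (\<forall>a \<in> Ob C. \<forall>x \<in> obj_map D a. ?u (?R `` {(a, x)}) = q a x)"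
    using some cocone by (auto simp: colimit_def quotient_def)
  fix u
  assume u: "u \<in> colimit C D \<rightarrow>\<^sub>E T \<and> (\<forall>a \<in> Ob C. \<forall>x \<in> obj_map D a. u (?R `` {(a, x)}) = q a x)"
  show "u = ?u"
  proof
    fix c
    show "u c = ?u c"
    proof (cases "c \<in> colimit C D")
      case True
      then obtain a x where "a \<in> Ob C" "x \<in> obj_map D a" "c = ?R `` {(a, x)}"
        by (auto simp: colimit_def quotient_def)
      then show ?thesis using True u some[of "(a, x)"] by auto
    next
      case False
      then show ?thesis using u by (auto simp: PiE_def extensional_def)
    qed
  qed
qed

lemma colimit_map_class:
  assumes "\<And>f x. \<lbrakk>f \<in> Arr C; x \<in> obj_map D (Dom C f)\<rbrakk> \<Longrightarrow>
      ((Dom C f, \<phi> (Dom C f) x), (Cod C f, \<phi> (Cod C f) (arr_map D f x))) \<in> colimit_rel C E"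
  shows "colimit_map C E \<phi> (colimit_rel C D `` {(a, x)}) = colimit_rel C E `` {(a, \<phi> a x)}"
proof -
  let ?h = "\<lambda>(a, x). (a, \<phi> a x)"
  have E: "sym (colimit_rel C E)" "trans (colimit_rel C E)"
    using equiv_colimit_rel[of C E] by (auto elim: equivE)
  have step: "(?h y, ?h z) \<in> colimit_rel C E" if "(y, z) \<in> colimit_rel C D" for y z
    using that
  proof (induction rule: colimit_rel_induct)
    case (arr f x)
    then show ?case using assms by simp
  next
    case (sym y z)
    then show ?case using E(1) by (meson symD)
  next
    case (trans x y z)
    then show ?case using E(2) by (meson transD)
  qed (rule colimit_rel_refl)
  show ?thesis
  proof
    show "colimit_map C E \<phi> (colimit_rel C D `` {(a, x)}) \<subseteq> colimit_rel C E `` {(a, \<phi> a x)}"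
    proof
      fix w assume "w \<in> colimit_map C E \<phi> (colimit_rel C D `` {(a, x)})"
      then obtain z where "((a, x), z) \<in> colimit_rel C D" "(?h z, w) \<in> colimit_rel C E"
        by (auto simp: colimit_map_def)
      then have "(?h (a, x), w) \<in> colimit_rel C E"
        using step E(2) by (meson transD)
      then show "w \<in> colimit_rel C E `` {(a, \<phi> a x)}" by simp
    qed
    show "colimit_rel C E `` {(a, \<phi> a x)} \<subseteq> colimit_map C E \<phi> (colimit_rel C D `` {(a, x)})"
      using colimit_rel_refl by (force simp: colimit_map_def)
  qed
qed


section \<open>Commutation of limits with colimits\<close>

definition fix_left ::
    "('o, 'a) cat \<Rightarrow> ('o \<times> 'p, 'a \<times> 'b, 'c) set_functor \<Rightarrow> 'o \<Rightarrow> ('p, 'b, 'c) set_functor" where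
  "fix_left I F i = \<lparr>obj_map = (\<lambda>j. obj_map F (i, j)), arr_map = (\<lambda>v. arr_map F (Id I i, v))\<rparr>"

definition fix_right ::
    "('p, 'b) cat \<Rightarrow> ('o \<times> 'p, 'a \<times> 'b, 'c) set_functor \<Rightarrow> 'p \<Rightarrow> ('o, 'a, 'c) set_functor" where
  "fix_right J F j = \<lparr>obj_map = (\<lambda>i. obj_map F (i, j)), arr_map = (\<lambda>u. arr_map F (u, Id J j))\<rparr>"

text \<open>The functor \<open>j \<mapsto> lim\<^sub>i F (i, j)\<close> on \<open>J\<close>.\<close>

definition lim_functor ::
    "('o, 'a) cat \<Rightarrow> ('p, 'b) cat \<Rightarrow> ('o \<times> 'p, 'a \<times> 'b, 'c) set_functor
      \<Rightarrow> ('p, 'b, 'o \<Rightarrow> 'c) set_functor" where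
  "lim_functor I J F =
    \<lparr>obj_map = (\<lambda>j. limit I (fix_right J F j)),
     arr_map = (\<lambda>v. limit_map I (\<lambda>i. arr_map F (Id I i, v)))\<rparr>"

text \<open>The functor \<open>i \<mapsto> colim\<^sub>j F (i, j)\<close> on \<open>I\<close>.\<close>

definition colim_functor ::
    "('o, 'a) cat \<Rightarrow> ('p, 'b) cat \<Rightarrow> ('o \<times> 'p, 'a \<times> 'b, 'c) set_functor
      \<Rightarrow> ('o, 'a, ('p \<times> 'c) set) set_functor" where
  "colim_functor I J F =
    \<lparr>obj_map = (\<lambda>i. colimit J (fix_left I F i)),
     arr_map = (\<lambda>u. colimit_map J (fix_left I F (Cod I u)) (\<lambda>j. arr_map F (u, Id J j)))\<rparr>"

text \<open>The canonical map from \<open>colim\<^sub>j lim\<^sub>i F (i, j)\<close> to \<open>lim\<^sub>i colim\<^sub>j F (i, j)\<close>: its component at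
  \<open>i\<close> is induced by the projections \<open>s \<mapsto> s i\<close> from \<open>lim\<^sub>i F (i, j)\<close> to \<open>F (i, j)\<close>, so that the class
  of \<open>(j, s)\<close> goes to the family of the classes of \<open>(j, s i)\<close>.\<close>

definition canonical_map ::
    "('o, 'a) cat \<Rightarrow> ('p, 'b) cat \<Rightarrow> ('o \<times> 'p, 'a \<times> 'b, 'c) set_functor
      \<Rightarrow> ('p \<times> ('o \<Rightarrow> 'c)) set \<Rightarrow> ('o \<Rightarrow> ('p \<times> 'c) set)" where
  "canonical_map I J F c = (\<lambda>i \<in> Ob I. colimit_map J (fix_left I F i) (\<lambda>j s. s i) c)"

text \<open>The type argument bounds the sets that functors may take as values: they are the subsets
  of \<open>'c\<close>. Commutation in the category of all sets is the statement for arbitrary \<open>'c\<close>.\<close>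

definition limits_commute_with_colimits ::
    "'c itself \<Rightarrow> ('o, 'a) cat \<Rightarrow> ('p, 'b) cat \<Rightarrow> bool" where
  "limits_commute_with_colimits (_ :: 'c itself) I J \<longleftrightarrow>
    (\<forall>F :: ('o \<times> 'p, 'a \<times> 'b, 'c) set_functor. functor_to_Set (prod_cat I J) F \<longrightarrow>
      bij_betw (canonical_map I J F)
        (colimit J (lim_functor I J F))
        (limit I (colim_functor I J F)))"

context
  fixes I :: "('o, 'a) cat" and J :: "('p, 'b) cat"
    and F :: "('o \<times> 'p, 'a \<times> 'b, 'c) set_functor"
  assumes I: "small_category I" and J: "small_category J"
    and F: "functor_to_Set (prod_cat I J) F"
begin

interpretation I: small_category I by (rule I)
interpretation J: small_category J by (rule J)
interpretation F: functor_to_Set "prod_cat I J" F by (rule F)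

lemma F_in:
  "\<lbrakk>u \<in> Arr I; v \<in> Arr J; x \<in> obj_map F (Dom I u, Dom J v)\<rbrakk>
    \<Longrightarrow> arr_map F (u, v) x \<in> obj_map F (Cod I u, Cod J v)"
  using F.arr_map_in[of "(u, v)" x] by (simp add: prod_cat_def)

lemma F_Id:
  "\<lbrakk>i \<in> Ob I; j \<in> Ob J; x \<in> obj_map F (i, j)\<rbrakk> \<Longrightarrow> arr_map F (Id I i, Id J j) x = x"
  using F.arr_map_Id[of "(i, j)" x] by (simp add: prod_cat_def)

lemma F_Comp:
  "\<lbrakk>u \<in> Arr I; u' \<in> Arr I; Dom I u' = Cod I u; v \<in> Arr J; v' \<in> Arr J; Dom J v' = Cod J v;
     x \<in> obj_map F (Dom I u, Dom J v)\<rbrakk>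
    \<Longrightarrow> arr_map F (u', v') (arr_map F (u, v) x) = arr_map F (Comp I u' u, Comp J v' v) x"
  using F.arr_map_Comp[of "(u, v)" "(u', v')" x] by (simp add: prod_cat_def)

lemma interchange:
  assumes "u \<in> Arr I" "v \<in> Arr J" "x \<in> obj_map F (Dom I u, Dom J v)"
  shows "arr_map F (Id I (Cod I u), v) (arr_map F (u, Id J (Dom J v)) x) = arr_map F (u, v) x"
    and "arr_map F (u, Id J (Cod J v)) (arr_map F (Id I (Dom I u), v) x) = arr_map F (u, v) x"
proof -
  show "arr_map F (Id I (Cod I u), v) (arr_map F (u, Id J (Dom J v)) x) = arr_map F (u, v) x"
    using assms
    by (subst F_Comp) (simp_all add: I.Id_in J.Id_in I.Cod_in J.Dom_in I.Dom_Id J.Cod_Id J.Dom_Id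
        I.Comp_Id_left J.Comp_Id_right)
  show "arr_map F (u, Id J (Cod J v)) (arr_map F (Id I (Dom I u), v) x) = arr_map F (u, v) x"
    using assms
    by (subst F_Comp) (simp_all add: I.Id_in J.Id_in I.Dom_in J.Cod_in I.Dom_Id I.Cod_Id J.Dom_Id
        I.Comp_Id_right J.Comp_Id_left)
qed

lemma functor_lim_functor: "functor_to_Set J (lim_functor I J F)"
proof
  fix v s
  assume v: "v \<in> Arr J" and "s \<in> obj_map (lim_functor I J F) (Dom J v)"
  then have s: "s \<in> limit I (fix_right J F (Dom J v))" by (simp add: lim_functor_def)
  have s_in: "s i \<in> obj_map F (i, Dom J v)" if "i \<in> Ob I" for i
    using s that by (auto simp: limit_def fix_right_def)
  have s_eq: "arr_map F (u, Id J (Dom J v)) (s (Dom I u)) = s (Cod I u)" if "u \<in> Arr I" for u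
    using s that by (auto simp: limit_def fix_right_def)
  have 1: "arr_map F (Id I i, v) (s i) \<in> obj_map F (i, Cod J v)" if "i \<in> Ob I" for i
    using F_in[of "Id I i" v "s i"] s_in[OF that] that v by (simp add: I.Id_in I.Dom_Id I.Cod_Id)
  have 2: "arr_map F (u, Id J (Cod J v)) (arr_map F (Id I (Dom I u), v) (s (Dom I u)))
      = arr_map F (Id I (Cod I u), v) (s (Cod I u))" if "u \<in> Arr I" for u
    using interchange[OF that v s_in[OF I.Dom_in[OF that]]] s_eq[OF that] by simp
  show "arr_map (lim_functor I J F) v s \<in> obj_map (lim_functor I J F) (Cod J v)"
    using 1 2 by (simp add: lim_functor_def limit_def limit_map_def fix_right_def I.Dom_in I.Cod_in)
next
  fix j s assume "j \<in> Ob J" and "s \<in> obj_map (lim_functor I J F) j"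
  then show "arr_map (lim_functor I J F) (Id J j) s = s"
    using F_Id
    by (auto simp: lim_functor_def limit_def limit_map_def fix_right_def fun_eq_iff
        PiE_def Pi_def extensional_def)
next
  fix v w s
  assume vw: "v \<in> Arr J" "w \<in> Arr J" "Dom J w = Cod J v"
    and "s \<in> obj_map (lim_functor I J F) (Dom J v)"
  then have s_in: "s i \<in> obj_map F (i, Dom J v)" if "i \<in> Ob I" for i
    using that by (auto simp: lim_functor_def limit_def fix_right_def)
  have "arr_map F (Id I i, Comp J w v) (s i)
      = arr_map F (Id I i, w) (arr_map F (Id I i, v) (s i))" if "i \<in> Ob I" for i
    using F_Comp[of "Id I i" "Id I i" v w "s i"] I.Comp_Id_right[of "Id I i"] s_in[OF that] that vw
    by (simp add: I.Id_in I.Dom_Id I.Cod_Id)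
  then show "arr_map (lim_functor I J F) (Comp J w v) s
      = arr_map (lim_functor I J F) w (arr_map (lim_functor I J F) v s)"
    by (auto simp: lim_functor_def limit_map_def fun_eq_iff)
qed

lemma colim_functor_class:
  assumes "u \<in> Arr I"
  shows "arr_map (colim_functor I J F) u (colimit_rel J (fix_left I F (Dom I u)) `` {(j, x)})
    = colimit_rel J (fix_left I F (Cod I u)) `` {(j, arr_map F (u, Id J j) x)}"
  unfolding colim_functor_def set_functor.simps
proof (rule colimit_map_class)
  fix v x assume v: "v \<in> Arr J" and "x \<in> obj_map (fix_left I F (Dom I u)) (Dom J v)"
  then have x: "x \<in> obj_map F (Dom I u, Dom J v)" by (simp add: fix_left_def)
  have "arr_map F (u, Id J (Dom J v)) x \<in> obj_map F (Cod I u, Dom J v)"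
    using F_in[of u "Id J (Dom J v)" x] x assms v
    by (simp add: J.Id_in J.Dom_in J.Dom_Id J.Cod_Id)
  then have "((Dom J v, arr_map F (u, Id J (Dom J v)) x),
      (Cod J v, arr_map F (Id I (Cod I u), v) (arr_map F (u, Id J (Dom J v)) x)))
      \<in> colimit_rel J (fix_left I F (Cod I u))"
    using colimit_rel_arr[OF v, of _ "fix_left I F (Cod I u)"] by (simp add: fix_left_def)
  then show "((Dom J v, arr_map F (u, Id J (Dom J v)) x),
      (Cod J v, arr_map F (u, Id J (Cod J v)) (arr_map (fix_left I F (Dom I u)) v x)))
      \<in> colimit_rel J (fix_left I F (Cod I u))"
    using interchange[OF assms v x] by (simp add: fix_left_def)
qed

lemma functor_colim_functor: "functor_to_Set I (colim_functor I J F)"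
proof -
  let ?R = "\<lambda>i. colimit_rel J (fix_left I F i)"
  have elim: "\<exists>j x. j \<in> Ob J \<and> x \<in> obj_map F (i, j) \<and> c = ?R i `` {(j, x)}"
    if "c \<in> obj_map (colim_functor I J F) i" for c i
    using that by (auto simp: colim_functor_def colimit_def quotient_def fix_left_def)
  have intro: "?R i `` {(j, x)} \<in> obj_map (colim_functor I J F) i"
    if "j \<in> Ob J" "x \<in> obj_map F (i, j)" for i j x
    using that by (auto simp: colim_functor_def colimit_def quotient_def fix_left_def)
  show ?thesis
  proof
    fix u c assume u: "u \<in> Arr I" and "c \<in> obj_map (colim_functor I J F) (Dom I u)"
    then obtain j x where c: "j \<in> Ob J" "x \<in> obj_map F (Dom I u, j)" "c = ?R (Dom I u) `` {(j, x)}"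
      using elim by blast
    have "arr_map F (u, Id J j) x \<in> obj_map F (Cod I u, j)"
      using F_in[of u "Id J j" x] c u by (simp add: J.Id_in J.Dom_Id J.Cod_Id)
    then show "arr_map (colim_functor I J F) u c \<in> obj_map (colim_functor I J F) (Cod I u)"
      using c colim_functor_class[OF u] intro by simp
  next
    fix i c assume i: "i \<in> Ob I" and "c \<in> obj_map (colim_functor I J F) i"
    then obtain j x where c: "j \<in> Ob J" "x \<in> obj_map F (i, j)" "c = ?R i `` {(j, x)}"
      using elim by blast
    then show "arr_map (colim_functor I J F) (Id I i) c = c"
      using colim_functor_class[OF I.Id_in[OF i], of j x] F_Id i by (simp add: I.Dom_Id I.Cod_Id)
  next
    fix u w c
    assume uw: "u \<in> Arr I" "w \<in> Arr I" "Dom I w = Cod I u"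
      and "c \<in> obj_map (colim_functor I J F) (Dom I u)"
    then obtain j x where c: "j \<in> Ob J" "x \<in> obj_map F (Dom I u, j)" "c = ?R (Dom I u) `` {(j, x)}"
      using elim by blast
    have "arr_map F (w, Id J j) (arr_map F (u, Id J j) x) = arr_map F (Comp I w u, Id J j) x"
      using F_Comp[of u w "Id J j" "Id J j" x] J.Comp_Id_right[of "Id J j"] c uw
      by (simp add: J.Id_in J.Dom_Id J.Cod_Id)
    then show "arr_map (colim_functor I J F) (Comp I w u) c
        = arr_map (colim_functor I J F) w (arr_map (colim_functor I J F) u c)"
      using colim_functor_class[OF I.Comp_in[OF uw(1,2,3)], of j x] colim_functor_class[OF uw(1)]
        colim_functor_class[OF uw(2)] c uw
      by (simp add: I.Dom_Comp I.Cod_Comp)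
  qed
qed

lemma canonical_map_class:
  assumes "i \<in> Ob I"
  shows "canonical_map I J F (colimit_rel J (lim_functor I J F) `` {(j, s)}) i
    = colimit_rel J (fix_left I F i) `` {(j, s i)}"
proof -
  have "colimit_map J (fix_left I F i) (\<lambda>j s. s i) (colimit_rel J (lim_functor I J F) `` {(j, s)})
    = colimit_rel J (fix_left I F i) `` {(j, s i)}"
  proof (rule colimit_map_class)
    fix v t assume v: "v \<in> Arr J" and "t \<in> obj_map (lim_functor I J F) (Dom J v)"
    then have "t i \<in> obj_map (fix_left I F i) (Dom J v)"
      using assms by (auto simp: lim_functor_def limit_def fix_right_def fix_left_def)
    from colimit_rel_arr[OF v this]
    show "((Dom J v, t i), (Cod J v, arr_map (lim_functor I J F) v t i))
        \<in> colimit_rel J (fix_left I F i)"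
      using assms by (simp add: lim_functor_def limit_map_def fix_left_def)
  qed
  then show ?thesis using assms by (simp add: canonical_map_def)
qed

end

end

theory Submission
  imports Defs "HOL-Algebra.Multiplicative_Group"
begin

text \<open>A functor on the product of the two groups is a set with commuting actions of \<open>G\<close> and \<open>H\<close>,
  and the canonical map sends the \<open>H\<close>-orbit of a \<open>G\<close>-fixed point to itself. It is injective
  because \<open>H\<close> preserves the \<open>G\<close>-fixed points. For surjectivity, let \<open>x\<close> have a \<open>G\<close>-stable
  \<open>H\<close>-orbit. Then for every \<open>g\<close> there is \<open>h\<close> with \<open>g x = h x\<close>, so \<open>(g, h\<^sup>-\<^sup>1)\<close> fixes \<open>x\<close>, and so do
  its powers; by coprimality, \<open>(g, 1)\<close> is one of them. Hence \<open>x\<close> is itself fixed by \<open>G\<close>.\<close>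

lemma functor_fix_left:
  assumes I: "small_category I" and J: "small_category J"
    and F: "functor_to_Set (prod_cat I J) F" and i: "i \<in> Ob I"
  shows "functor_to_Set J (fix_left I F i)"
proof -
  interpret I: small_category I by fact
  interpret J: small_category J by fact
  have Id: "Comp I (Id I i) (Id I i) = Id I i"
    using I.Comp_Id_right[OF I.Id_in[OF i]] i by (simp add: I.Dom_Id)
  show ?thesis
  proof
    fix v x assume "v \<in> Arr J" "x \<in> obj_map (fix_left I F i) (Dom J v)"
    then show "arr_map (fix_left I F i) v x \<in> obj_map (fix_left I F i) (Cod J v)"
      using F_in[OF I J F I.Id_in[OF i], of v x] i by (simp add: fix_left_def I.Dom_Id I.Cod_Id)
  next
    fix j x assume "j \<in> Ob J" "x \<in> obj_map (fix_left I F i) j"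
    then show "arr_map (fix_left I F i) (Id J j) x = x"
      using F_Id[OF I J F i] by (simp add: fix_left_def)
  next
    fix v w x
    assume "v \<in> Arr J" "w \<in> Arr J" "Dom J w = Cod J v" "x \<in> obj_map (fix_left I F i) (Dom J v)"
    then show "arr_map (fix_left I F i) (Comp J w v) x
        = arr_map (fix_left I F i) w (arr_map (fix_left I F i) v x)"
      using F_Comp[OF I J F I.Id_in[OF i] I.Id_in[OF i], of v w x] i
      by (simp add: fix_left_def I.Dom_Id I.Cod_Id Id)
  qed
qed

text \<open>The generated equivalence relation is the orbit relation of the action: products of
  group elements compress a chain of arrows to a single one, and inverses reverse it.\<close>

lemma colimit_rel_group_cat_iff:
  assumes "group H" and D: "functor_to_Set (group_cat H) D" and x: "x \<in> obj_map D ()"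
  shows "(((), x), ((), y)) \<in> colimit_rel (group_cat H) D
    \<longleftrightarrow> (\<exists>h \<in> carrier H. y = arr_map D h x)"
proof -
  interpret H: group H by fact
  interpret D: functor_to_Set "group_cat H" D by fact
  have D_in: "arr_map D h x \<in> obj_map D ()" if "h \<in> carrier H" "x \<in> obj_map D ()" for h x
    using D.arr_map_in[of h x] that by (simp add: group_cat_def)
  have D_one: "arr_map D \<one>\<^bsub>H\<^esub> x = x" if "x \<in> obj_map D ()" for x
    using D.arr_map_Id[of "()" x] that by (simp add: group_cat_def)
  have D_mult: "arr_map D h (arr_map D k x) = arr_map D (h \<otimes>\<^bsub>H\<^esub> k) x"
    if "h \<in> carrier H" "k \<in> carrier H" "x \<in> obj_map D ()" for h k x
    using D.arr_map_Comp[of k h x] that by (simp add: group_cat_def)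
  \<comment> \<open>The alternative \<open>y = z\<close> is there because \<open>colimit_rel\<close>
    is reflexive also outside the values of \<open>D\<close>. Membership of \<open>snd y\<close> is
    carried along because the action laws hold only on \<open>obj_map D ()\<close>.\<close>
  have orbit: "y = z \<or> snd y \<in> obj_map D () \<and> (\<exists>h \<in> carrier H. snd z = arr_map D h (snd y))"
    if "(y, z) \<in> colimit_rel (group_cat H) D" for y z
    using that
  proof (induction rule: colimit_rel_induct)
    case (arr f x)
    then show ?case by (auto simp: group_cat_def)
  next
    case (sym y z)
    then show ?case
    proof (elim disjE conjE bexE)
      fix h assume h: "h \<in> carrier H" "snd y \<in> obj_map D ()" "snd z = arr_map D h (snd y)"
      then have "snd y = arr_map D (inv\<^bsub>H\<^esub> h) (snd z)"
        by (simp add: D_mult D_one)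
      then show ?thesis using h D_in by auto
    qed simp
  next
    case (trans x y z)
    then show ?case using D_mult H.m_closed by metis
  qed simp
  show ?thesis
  proof
    assume "(((), x), ((), y)) \<in> colimit_rel (group_cat H) D"
    then show "\<exists>h \<in> carrier H. y = arr_map D h x"
      using orbit D_one[OF x] H.one_closed by (metis snd_conv)
  next
    assume "\<exists>h \<in> carrier H. y = arr_map D h x"
    then show "(((), x), ((), y)) \<in> colimit_rel (group_cat H) D"
      using colimit_rel_arr[of _ "group_cat H" x D] x by (auto simp: group_cat_def)
  qed
qed

text \<open>Bezout gives a multiple \<open>n\<close> of \<open>order H\<close> that is 1 modulo
  \<open>order G\<close>, and an element raised to the order of its group is the identity. For a
  pair in the product group, the power \<open>n\<close> thus keeps the \<open>G\<close>-coordinate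
  and kills the \<open>H\<close>-coordinate.\<close>

lemma coprime_orders_pow:
  assumes "group G" and "group H" and "finite (carrier H)"
    and "coprime (order G) (order H)"
  obtains n :: nat where "\<And>g. g \<in> carrier G \<Longrightarrow> g [^]\<^bsub>G\<^esub> n = g"
    and "\<And>h. h \<in> carrier H \<Longrightarrow> h [^]\<^bsub>H\<^esub> n = \<one>\<^bsub>H\<^esub>"
proof -
  interpret G: group G by fact
  interpret H: group H by fact
  \<comment> \<open>Bezout over the naturals, with the surplus on the side of
    \<open>order H\<close>, asks for \<open>order H\<close> to be nonzero. Finiteness of
    \<open>H\<close> ensures this, as \<open>order\<close> is 0 on an infinite carrier.\<close>
  have "order H \<noteq> 0" using H.order_gt_0_iff_finite assms(3) by simp
  then obtain a b where ab: "order H * a = order G * b + gcd (order H) (order G)"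
    using bezout_nat by blast
  then have n: "order H * a = order G * b + 1"
    using assms(4) by (simp add: coprime_iff_gcd_eq_1 gcd.commute)
  show ?thesis
  proof
    fix g assume g: "g \<in> carrier G"
    then show "g [^]\<^bsub>G\<^esub> (order H * a) = g"
      unfolding n using G.pow_order_eq_1[OF g]
      by (simp add: G.nat_pow_mult[symmetric] G.nat_pow_pow[symmetric])
  next
    fix h assume h: "h \<in> carrier H"
    then show "h [^]\<^bsub>H\<^esub> (order H * a) = \<one>\<^bsub>H\<^esub>"
      using H.pow_order_eq_1[OF h] by (simp add: H.nat_pow_pow[symmetric])
  qed
qed

theorem lemma3p1:
  fixes G :: "('g, 'x) monoid_scheme" and H :: "('h, 'y) monoid_scheme"
  assumes "group G" and "group H"
    and "finite (carrier G)" and "finite (carrier H)"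
    and "coprime (order G) (order H)"
  shows "limits_commute_with_colimits TYPE('c) (group_cat G) (group_cat H)"
  unfolding limits_commute_with_colimits_def
proof (intro allI impI)
  fix F :: "(unit \<times> unit, 'g \<times> 'h, 'c) set_functor"
  let ?I = "group_cat G" and ?J = "group_cat H"
  assume F: "functor_to_Set (prod_cat ?I ?J) F"
  interpret G: group G by fact
  interpret H: group H by fact
  note I = small_category_group_cat[OF assms(1)] and J = small_category_group_cat[OF assms(2)]
  note IJF = I J F
  define X where "X = obj_map F ((), ())"
  define act where "act g h = arr_map F (g, h)" for g h
  have act_one: "act \<one>\<^bsub>G\<^esub> \<one>\<^bsub>H\<^esub> x = x" if "x \<in> X" for x
    using F_Id[OF IJF, of "()" "()" x] that by (simp add: X_def act_def group_cat_def)
  have act_mult: "act g h (act g' h' x) = act (g \<otimes>\<^bsub>G\<^esub> g') (h \<otimes>\<^bsub>H\<^esub> h') x"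
    if "g \<in> carrier G" "g' \<in> carrier G" "h \<in> carrier H" "h' \<in> carrier H" "x \<in> X" for g g' h h' x
    using F_Comp[OF IJF, of g' g h' h x] that by (simp add: X_def act_def group_cat_def)
  have fixed_pow: "act (g [^]\<^bsub>G\<^esub> n) (h [^]\<^bsub>H\<^esub> n) x = x"
    if "g \<in> carrier G" "h \<in> carrier H" "x \<in> X" "act g h x = x" for g h x and n :: nat
  proof (induction n)
    case 0
    then show ?case using act_one that by simp
  next
    case (Suc n)
    then show ?case using act_mult[of "g [^]\<^bsub>G\<^esub> n" g "h [^]\<^bsub>H\<^esub> n" h x] that by simp
  qed
  have fixed: "act g \<one>\<^bsub>H\<^esub> x = x"
    if g: "g \<in> carrier G" and h: "h \<in> carrier H" and x: "x \<in> X"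
      and eq: "act g \<one>\<^bsub>H\<^esub> x = act \<one>\<^bsub>G\<^esub> h x" for g h x
  proof -
    \<comment> \<open>The inverse of \<open>h\<close> is applied to both sides of \<open>eq\<close>,
      so that the pair of \<open>g\<close> and this inverse stabilises \<open>x\<close>.\<close>
    have "act g (inv\<^bsub>H\<^esub> h) x = act \<one>\<^bsub>G\<^esub> (inv\<^bsub>H\<^esub> h) (act g \<one>\<^bsub>H\<^esub> x)"
      using g h x by (simp add: act_mult)
    also have "\<dots> = x"
      using g h x by (simp add: eq act_mult act_one)
    finally have "act g (inv\<^bsub>H\<^esub> h) x = x" .
    moreover obtain n :: nat where "g [^]\<^bsub>G\<^esub> n = g" "(inv\<^bsub>H\<^esub> h) [^]\<^bsub>H\<^esub> n = \<one>\<^bsub>H\<^esub>"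
      using coprime_orders_pow[OF assms(1,2,4,5)] g H.inv_closed[OF h] by metis
    ultimately show ?thesis using fixed_pow[of g "inv\<^bsub>H\<^esub> h" x n] g h x by simp
  qed

  let ?R = "colimit_rel ?J (fix_left ?I F ())" and ?L = "colimit_rel ?J (lim_functor ?I ?J F)"
  let ?lim = "limit ?I (fix_right ?J F ())" and ?can = "canonical_map ?I ?J F"
  define cls where "cls x = ?R `` {((), x)}" for x
  \<comment> \<open>Only \<open>x\<close> has to lie in \<open>X\<close>: either side then forces
    \<open>y\<close> into the orbit of \<open>x\<close>. Classes can be compared for arbitrary
    \<open>y\<close> because \<open>colimit_rel\<close> is an equivalence on
    \<open>UNIV\<close>.\<close>
  have cls_eq_iff: "cls x = cls y \<longleftrightarrow> (\<exists>h \<in> carrier H. y = act \<one>\<^bsub>G\<^esub> h x)"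
    if "x \<in> X" for x y
  proof -
    have "functor_to_Set ?J (fix_left ?I F ())"
      using functor_fix_left[OF IJF] by (simp add: group_cat_def)
    then have "(((), x), ((), y)) \<in> ?R \<longleftrightarrow> (\<exists>h \<in> carrier H. y = act \<one>\<^bsub>G\<^esub> h x)"
      using colimit_rel_group_cat_iff[OF assms(2), of "fix_left ?I F ()" x y] that
      by (simp add: fix_left_def X_def act_def group_cat_def)
    then show ?thesis
      unfolding cls_def by (subst eq_equiv_class_iff[OF equiv_colimit_rel]) auto
  qed
  \<comment> \<open>The one object exhausts the type \<open>unit\<close>, so extensionality is no
    constraint and a family amounts to its value at \<open>()\<close>. Limit points are therefore
    the fixed points of \<open>G\<close>.\<close>
  have lim_iff: "s \<in> ?lim \<longleftrightarrow> s () \<in> X \<and> (\<forall>g \<in> carrier G. act g \<one>\<^bsub>H\<^esub> (s ()) = s ())" for s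
    by (auto simp: limit_def fix_right_def group_cat_def X_def act_def PiE_iff extensional_def)
  have colim_lim: "colimit ?J (lim_functor ?I ?J F) = {?L `` {((), s)} | s. s \<in> ?lim}"
    by (auto simp: colimit_def quotient_def lim_functor_def group_cat_def)
  have can: "?can (?L `` {((), s)}) = (\<lambda>_. cls (s ()))" for s
    using canonical_map_class[OF IJF, of "()" "()" s]
    by (auto simp: cls_def group_cat_def)
  \<comment> \<open>The points of the target are the \<open>G\<close>-stable
    \<open>H\<close>-orbits. The equation has the representative \<open>x\<close> on the left so
    that \<open>cls_eq_iff\<close> applies to it directly.\<close>
  have lim_colim_iff: "t \<in> limit ?I (colim_functor ?I ?J F) \<longleftrightarrow>
      (\<exists>x \<in> X. t = (\<lambda>_. cls x) \<and>
        (\<forall>g \<in> carrier G. cls x = cls (act g \<one>\<^bsub>H\<^esub> x)))" for t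
  proof -
    have arr: "arr_map (colim_functor ?I ?J F) g (cls x) = cls (act g \<one>\<^bsub>H\<^esub> x)"
      if "g \<in> carrier G" for g x
      using colim_functor_class[OF IJF, of g "()" x] that
      by (simp add: cls_def act_def group_cat_def)
    have obj: "obj_map (colim_functor ?I ?J F) () = cls ` X"
      by (auto simp: colim_functor_def colimit_def quotient_def fix_left_def X_def cls_def
          group_cat_def)
    have "t \<in> limit ?I (colim_functor ?I ?J F) \<longleftrightarrow>
        t () \<in> obj_map (colim_functor ?I ?J F) () \<and>
        (\<forall>g \<in> carrier G. arr_map (colim_functor ?I ?J F) g (t ()) = t ())"
      by (auto simp: limit_def group_cat_def PiE_iff extensional_def)
    also have "\<dots> \<longleftrightarrow> (\<exists>x \<in> X. t () = cls x \<and>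
        (\<forall>g \<in> carrier G. arr_map (colim_functor ?I ?J F) g (cls x) = cls x))"
      unfolding obj by force
    also have "\<dots> \<longleftrightarrow> (\<exists>x \<in> X. t = (\<lambda>_. cls x) \<and>
        (\<forall>g \<in> carrier G. cls x = cls (act g \<one>\<^bsub>H\<^esub> x)))"
      by (intro bex_cong conj_cong ball_cong refl) (auto simp: arr)
    finally show ?thesis .
  qed

  show "bij_betw ?can (colimit ?J (lim_functor ?I ?J F)) (limit ?I (colim_functor ?I ?J F))"
  proof (rule bij_betw_imageI)
    show "inj_on ?can (colimit ?J (lim_functor ?I ?J F))"
    proof (rule inj_onI)
      fix c d
      assume "c \<in> colimit ?J (lim_functor ?I ?J F)" "d \<in> colimit ?J (lim_functor ?I ?J F)"
        and eq: "?can c = ?can d"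
      then obtain s t where s: "s \<in> ?lim" "c = ?L `` {((), s)}" and t: "d = ?L `` {((), t)}"
        unfolding colim_lim by blast
      then have "cls (s ()) = cls (t ())"
        using eq by (simp add: can fun_eq_iff)
      then obtain h where h: "h \<in> carrier H" "t () = act \<one>\<^bsub>G\<^esub> h (s ())"
        using cls_eq_iff s lim_iff by blast
      \<comment> \<open>The \<open>h\<close> that relates the values also relates the families,
        since \<open>H\<close> acts on the limit pointwise and \<open>()\<close> is the only
        index.\<close>
      then have "t = arr_map (lim_functor ?I ?J F) h s"
        by (auto simp: lim_functor_def limit_map_def act_def group_cat_def)
      moreover have "s \<in> obj_map (lim_functor ?I ?J F) ()"
        using s by (simp add: lim_functor_def)
      ultimately have "(((), s), ((), t)) \<in> ?L"
        using colimit_rel_group_cat_iff[OF assms(2) functor_lim_functor[OF IJF]] h by blast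
      then show "c = d"
        unfolding s t by (rule equiv_class_eq[OF equiv_colimit_rel])
    qed
    show "?can ` colimit ?J (lim_functor ?I ?J F) = limit ?I (colim_functor ?I ?J F)"
    proof (intro equalityI subsetI)
      fix t assume "t \<in> ?can ` colimit ?J (lim_functor ?I ?J F)"
      then obtain s where s: "s \<in> ?lim" "t = (\<lambda>_. cls (s ()))"
        unfolding colim_lim using can by blast
      then show "t \<in> limit ?I (colim_functor ?I ?J F)"
        unfolding lim_colim_iff lim_iff by (intro bexI[of _ "s ()"]) auto
    next
      fix t assume "t \<in> limit ?I (colim_functor ?I ?J F)"
      then obtain x where x: "x \<in> X" "t = (\<lambda>_. cls x)"
        and stable: "\<And>g. g \<in> carrier G \<Longrightarrow> cls x = cls (act g \<one>\<^bsub>H\<^esub> x)"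
        unfolding lim_colim_iff by blast
      \<comment> \<open>Stability gives for each \<open>g\<close> an \<open>h\<close>, possibly
        depending on \<open>g\<close>, that moves \<open>x\<close> to the same point;
        \<open>fixed\<close> then shows that \<open>g\<close> fixes \<open>x\<close>. The constant
        family at \<open>x\<close> thus represents the preimage of \<open>t\<close>.\<close>
      have "(\<lambda>_. x) \<in> ?lim"
        unfolding lim_iff using x(1) stable cls_eq_iff[OF x(1)] fixed[OF _ _ x(1)] by blast
      moreover have "t = ?can (?L `` {((), \<lambda>_. x)})"
        using x(2) by (simp add: can)
      ultimately show "t \<in> ?can ` colimit ?J (lim_functor ?I ?J F)"
        unfolding colim_lim by blast
    qed
  qed
qed

end
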